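(* Let $(A_n)_{n=0}^{+\infty}$ be the sequence A198636 of the OEIS, i.e. $A_n=\frac{w(6,2n)}{2}$, where $w(6,l)$ is the total number of closed walks of length $l$ on the path graph $P_6$. Then $(A_n)_{n=0}^{+\infty}$ is a linear recurrent sequence which coincides with the sequence $(A(2,n))_{n=0}^{+\infty}$; in particular $$A_0=3,\quad A_1=5,\quad A_2=13,\quad A_{n+3}=5A_{n+2}-6A_{n+1}+A_n\quad(n\geq0).$$ Moreover, for all $n\geq0$, $$A_n=2^{2n}\left(\cos^{2n}\left(\frac{\pi}{7}\right)+\cos^{2n}\left(\frac{2\pi}{7}\right)+\cos^{2n}\left(\frac{3\pi}{7}\right)\right).$$
   Context: $P_6$ is the simple path with 6 vertices and 5 edges. A closed walk of length $l$ is a walk with $l$ steps along edges that ends at its starting vertex; $w(6,l)$ counts closed walks over all starting vertices, so $w(6,l)=\mathrm{Tr}(J_6^l)$ with $J_6$ the adjacency matrix of $P_6$ (in particular $w(6,0)=6$). $A(2,n)=\alpha^{2n}+\beta^{2n}+\gamma^{2n}$, where $\alpha,\beta,\gamma$ are the zeros of $x^3+x^2-2x-1$, namely $2\cos\frac{2\pi}{7}$, $2\cos\frac{4\pi}{7}$, $2\cos\frac{8\pi}{7}$. *)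

theory Defs
  imports Complex_Main "HOL-Computational_Algebra.Polynomial" "Graph_Theory.Pair_Digraph"
begin

text \<open>An undirected edge is represented by the two opposite arcs joining its end vertices.\<close>

definition path_graph :: "nat \<Rightarrow> nat pair_pre_digraph" where
  "path_graph n = \<lparr> pverts = {1..n},
     parcs = {(i, j). i \<in> {1..n} \<and> j \<in> {1..n} \<and> (j = Suc i \<or> i = Suc j)} \<rparr>"

lemma pair_graph_path_graph: "pair_graph (path_graph n)"
proof
  show "finite (parcs (path_graph n))"
    by (rule finite_subset[of _ "{1..n} \<times> {1..n}"]) (auto simp: path_graph_def)
qed (auto simp: path_graph_def symmetric_def arcs_ends_def arc_to_ends_def sym_def with_proj_def)

text \<open>The starting vertex is kept in the pair because the arc list of a walk of length 0 is empty.\<close>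

definition closed_walks :: "('a, 'b) pre_digraph \<Rightarrow> nat \<Rightarrow> ('a \<times> 'b list) set" where
  "closed_walks G l = {(u, p). pre_digraph.awalk G u p u \<and> length p = l}"

lemma finite_closed_walks:
  assumes "fin_digraph G"
  shows "finite (closed_walks G l)"
proof -
  interpret fin_digraph G by fact
  have "closed_walks G l \<subseteq> verts G \<times> {p. set p \<subseteq> arcs G \<and> length p = l}"
    by (auto simp: closed_walks_def awalk_def)
  moreover have "finite (verts G \<times> {p. set p \<subseteq> arcs G \<and> length p = l})"
    by (intro finite_cartesian_product finite_verts finite_lists_length_eq finite_arcs)
  ultimately show ?thesis by (rule finite_subset)
qed

definition path_closed_walks :: "nat \<Rightarrow> nat \<Rightarrow> nat" where
  "path_closed_walks n l = card (closed_walks (with_proj (path_graph n)) l)"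

lemma path_closed_walks_0: "path_closed_walks n 0 = n"
proof -
  have "closed_walks (with_proj (path_graph n)) 0 = (\<lambda>u. (u, [])) ` {1..n}"
    by (auto simp: closed_walks_def pre_digraph.awalk_def pre_digraph.cas.simps path_graph_def)
  then show ?thesis by (simp add: path_closed_walks_def card_image inj_on_def)
qed

definition A198636 :: "nat \<Rightarrow> real" where
  "A198636 n = real (path_closed_walks 6 (2 * n)) / 2"

text \<open>The three zeros of $x^3 + x^2 - 2x - 1$ are real, so the real roots are all of them.\<close>

definition A2 :: "nat \<Rightarrow> real" where
  "A2 n = (\<Sum>x\<in>#proots [:-1, -2, 1, 1:]. x ^ (2 * n))"

lemma two_cos_root:
  fixes t :: real
  assumes "cos (4 * t) = cos (3 * t)" and "cos t \<noteq> 1"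
  shows "(2 * cos t) ^ 3 + (2 * cos t) ^ 2 - 2 * (2 * cos t) - 1 = 0"
proof -
  define c where "c = cos t"
  have "cos (4 * t) = 2 * (cos (2 * t))\<^sup>2 - 1"
    using cos_double_cos[of "2 * t"] by simp
  then have "2 * (2 * c\<^sup>2 - 1)\<^sup>2 - 1 = 4 * c ^ 3 - 3 * c"
    using assms(1) by (simp add: cos_treble_cos cos_double_cos c_def)
  then have "(c - 1) * ((2 * c) ^ 3 + (2 * c) ^ 2 - 2 * (2 * c) - 1) = 0"
    by (simp add: algebra_simps power2_eq_square power3_eq_cube)
  then show ?thesis using assms(2) by (simp add: c_def)
qed

lemma proots_eq:
  "proots [:-1, -2, 1, 1:] =
     {#2 * cos (2 * pi / 7), 2 * cos (4 * pi / 7), 2 * cos (8 * pi / 7)#}"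
proof -
  define a b c where "a = 2 * cos (2 * pi / 7)" and "b = 2 * cos (4 * pi / 7)"
    and "c = 2 * cos (8 * pi / 7)"
  have c_alt: "c = 2 * cos (6 * pi / 7)"
    using cos_2pi_minus[of "6 * pi / 7"] by (simp add: c_def field_simps)
  have ineq: "cos (2 * pi / 7) < cos 0" "cos (4 * pi / 7) < cos (2 * pi / 7)"
    "cos (6 * pi / 7) < cos (4 * pi / 7)"
    by (rule cos_monotone_0_pi; simp)+
  have "cos (4 * (2 * pi / 7)) = cos (3 * (2 * pi / 7))"
    using cos_2pi_minus[of "3 * (2 * pi / 7)"] by (simp add: field_simps)
  then have ra: "a ^ 3 + a ^ 2 - 2 * a - 1 = 0"
    unfolding a_def using ineq by (intro two_cos_root) auto
  have "cos (4 * (4 * pi / 7)) = cos (2 * pi / 7)"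
    using cos_periodic[of "2 * pi / 7"] by (simp add: field_simps)
  moreover have "cos (3 * (4 * pi / 7)) = cos (2 * pi / 7)"
    using cos_2pi_minus[of "2 * pi / 7"] by (simp add: field_simps)
  ultimately have rb: "b ^ 3 + b ^ 2 - 2 * b - 1 = 0"
    unfolding b_def using ineq by (intro two_cos_root) auto
  have "cos (4 * (6 * pi / 7)) = cos (4 * pi / 7)"
  proof -
    have "cos (4 * (6 * pi / 7)) = cos (10 * pi / 7)"
      using cos_periodic[of "10 * pi / 7"] by (simp add: field_simps)
    also have "\<dots> = cos (4 * pi / 7)"
      using cos_2pi_minus[of "4 * pi / 7"] by (simp add: field_simps)
    finally show ?thesis .
  qed
  moreover have "cos (3 * (6 * pi / 7)) = cos (4 * pi / 7)"
    using cos_periodic[of "4 * pi / 7"] by (simp add: field_simps)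
  ultimately have rc: "c ^ 3 + c ^ 2 - 2 * c - 1 = 0"
    unfolding c_alt using ineq by (intro two_cos_root) auto
  have ne: "a - b \<noteq> 0" "b - c \<noteq> 0" "a - c \<noteq> 0"
    using ineq by (auto simp: a_def b_def c_alt)
  have "(a - b) * (a\<^sup>2 + a * b + b\<^sup>2 + a + b - 2) = 0"
    using ra rb by (simp add: algebra_simps power2_eq_square power3_eq_cube)
  then have e1: "a\<^sup>2 + a * b + b\<^sup>2 + a + b - 2 = 0" using ne by simp
  have "(b - c) * (b\<^sup>2 + b * c + c\<^sup>2 + b + c - 2) = 0"
    using rb rc by (simp add: algebra_simps power2_eq_square power3_eq_cube)
  then have e2: "b\<^sup>2 + b * c + c\<^sup>2 + b + c - 2 = 0" using ne by simp
  have "(a - c) * (a + b + c + 1) = 0"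
    using e1 e2 by (simp add: algebra_simps power2_eq_square)
  then have s1: "c = - 1 - a - b" using ne by simp
  have s2: "a * b + b * c + a * c = - 2"
    using e1 by (simp add: s1 algebra_simps power2_eq_square)
  have "a * (a\<^sup>2 + a - 2) = 1"
    using ra by (simp add: algebra_simps power2_eq_square power3_eq_cube)
  moreover have "a\<^sup>2 + a - 2 = b * c"
    using e1 by (simp add: s1 algebra_simps power2_eq_square)
  ultimately have s3: "a * (b * c) = 1" by simp
  have "[:-1, -2, 1, 1:] = [:-a, 1:] * [:-b, 1:] * [:-c, 1:]"
    using s1 s2 s3 by (simp add: algebra_simps)
  also have "proots \<dots> = {#a, b, c#}"
    by (simp add: proots_mult del: mult_pCons_left mult_pCons_right)
  finally show ?thesis by (simp add: a_def b_def c_def)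
qed

corollary A2_eq:
  "A2 n = (2 * cos (2 * pi / 7)) ^ (2 * n) + (2 * cos (4 * pi / 7)) ^ (2 * n)
     + (2 * cos (8 * pi / 7)) ^ (2 * n)"
  by (simp add: A2_def proots_eq del: mult_pCons_left)

definition linear_recurrent :: "(nat \<Rightarrow> 'a::comm_ring_1) \<Rightarrow> bool" where
  "linear_recurrent a \<longleftrightarrow>
     (\<exists>k c. k > 0 \<and> (\<forall>n. a (n + k) = (\<Sum>i<k. c i * a (n + i))))"

end

theory Submission
  imports Defs
begin

text \<open>Counting walks by their first arc shows that the numbers of walks of length \<open>l\<close> between fixed
  vertices of $P_6$ satisfy a linear system, which eliminates to
  $W_{l+6} + 6 W_{l+2} = 5 W_{l+4} + W_l$, the characteristic polynomial of $P_6$ being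
  $x^6 - 5x^4 + 6x^2 - 1$. This is $y^3 - 5y^2 + 6y - 1$ at $y = x^2$, and its zeros are the squares
  of the zeros of $x^3 + x^2 - 2x - 1$. So both sequences obey the same recurrence, and it suffices
  to compare three initial values.\<close>

section \<open>Counting walks\<close>

text \<open>Dropping the first arc of a closed walk leaves a walk that is in general not closed, so
  the recursion has to let the start vary while the end stays fixed.\<close>

definition walks :: "('a, 'b) pre_digraph \<Rightarrow> 'a \<Rightarrow> 'a \<Rightarrow> nat \<Rightarrow> 'b list set" where
  "walks G u v l = {p. pre_digraph.awalk G u p v \<and> length p = l}"

lemma closed_walks_eq_Sigma: "closed_walks G l = (SIGMA u : verts G. walks G u u l)"
  by (auto simp: closed_walks_def walks_def pre_digraph.awalk_def)

lemma walks_0: "walks G u v 0 = (if u \<in> verts G \<and> u = v then {[]} else {})"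
  by (auto simp: walks_def pre_digraph.awalk_def pre_digraph.cas.simps)

lemma walks_empty: "u \<notin> verts G \<Longrightarrow> walks G u v l = {}"
  by (auto simp: walks_def pre_digraph.awalk_def)

lemma (in wf_digraph) walks_Suc:
  "walks G u v (Suc l) = (\<Union>e\<in>out_arcs G u. (#) e ` walks G (head G e) v l)"
  by (auto simp: walks_def awalk_Cons_iff length_Suc_conv)

lemma (in fin_digraph) finite_walks: "finite (walks G u v l)"
  by (rule finite_subset[of _ "{p. set p \<subseteq> arcs G \<and> length p = l}"])
    (auto simp: walks_def awalk_def intro!: finite_lists_length_eq)

text \<open>The union over first arcs is disjoint, as lists with different heads differ, and
  prepending an arc is injective.\<close>

lemma (in fin_digraph) card_walks_Suc:
  "card (walks G u v (Suc l)) = (\<Sum>e\<in>out_arcs G u. card (walks G (head G e) v l))"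
proof -
  have "finite (out_arcs G u)" by (simp add: out_arcs_def)
  then show ?thesis
    unfolding walks_Suc by (subst card_UN_disjoint) (auto simp: finite_walks card_image)
qed

lemma (in fin_digraph) card_closed_walks:
  "card (closed_walks G l) = (\<Sum>u\<in>verts G. card (walks G u u l))"
  unfolding closed_walks_eq_Sigma by (rule card_SigmaI) (auto simp: finite_walks)

section \<open>Walks in path graphs\<close>

definition path_walks :: "nat \<Rightarrow> nat \<Rightarrow> nat \<Rightarrow> nat \<Rightarrow> nat" where
  "path_walks n u v l = card (walks (with_proj (path_graph n)) u v l)"

lemma fin_digraph_path_graph: "fin_digraph (with_proj (path_graph n))"
proof -
  interpret pair_graph "path_graph n" by (rule pair_graph_path_graph)
  show ?thesis by unfold_locales
qed

lemma path_walks_0: "path_walks n u v 0 = (if u \<in> {1..n} \<and> u = v then 1 else 0)"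
  by (simp add: path_walks_def walks_0 path_graph_def)

lemma path_walks_outside: "u \<notin> {1..n} \<Longrightarrow> path_walks n u v l = 0"
  by (simp add: path_walks_def walks_empty path_graph_def)

lemma path_walks_Suc:
  assumes "u \<in> {1..n}"
  shows "path_walks n u v (Suc l) = path_walks n (u - 1) v l + path_walks n (u + 1) v l"
proof -
  interpret fin_digraph "with_proj (path_graph n)" by (rule fin_digraph_path_graph)
  let ?N = "{u - 1, u + 1} \<inter> {1..n}"
  have arcs: "out_arcs (with_proj (path_graph n)) u = Pair u ` ?N"
    using assms by (auto simp: out_arcs_def path_graph_def)
  have "path_walks n u v (Suc l) = (\<Sum>w\<in>?N. path_walks n w v l)"
    by (simp add: path_walks_def card_walks_Suc arcs sum.reindex inj_on_def)
  \<comment> \<open>The would-be neighbours 0 and \<open>n + 1\<close> are not vertices and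
    contribute 0, so the end vertices need no separate formula.\<close>
  also have "\<dots> = (\<Sum>w\<in>{u - 1, u + 1}. path_walks n w v l)"
  proof (rule sum.mono_neutral_left)
    show "\<forall>w\<in>{u - 1, u + 1} - ?N. path_walks n w v l = 0"
      by (metis DiffE IntI path_walks_outside)
  qed auto
  finally show ?thesis by simp
qed

lemma path_closed_walks_eq: "path_closed_walks n l = (\<Sum>u=1..n. path_walks n u u l)"
  unfolding path_closed_walks_def path_walks_def
    fin_digraph.card_closed_walks[OF fin_digraph_path_graph]
  by (simp add: path_graph_def)

lemma path6_walks_Suc:
  "path_walks 6 1 v (Suc l) = path_walks 6 2 v l"
  "path_walks 6 2 v (Suc l) = path_walks 6 1 v l + path_walks 6 3 v l"
  "path_walks 6 3 v (Suc l) = path_walks 6 2 v l + path_walks 6 4 v l"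
  "path_walks 6 4 v (Suc l) = path_walks 6 3 v l + path_walks 6 5 v l"
  "path_walks 6 5 v (Suc l) = path_walks 6 4 v l + path_walks 6 6 v l"
  "path_walks 6 6 v (Suc l) = path_walks 6 5 v l"
  by (simp_all add: path_walks_Suc path_walks_outside flip: numeral_2_eq_2)

lemma atLeastAtMost_1_6: "{1..6::nat} = {1, 2, 3, 4, 5, 6}"
  by auto

text \<open>This is Cayley-Hamilton for the adjacency matrix, checked by hand: unfolding to length
  \<open>l\<close> turns both sides into the same linear combination of the six counts at
  \<open>l\<close>. The terms are arranged to avoid truncated subtraction on
  \<open>nat\<close>.\<close>

lemma path6_walks_recurrence:
  assumes "u \<in> {1..6}"
  shows "path_walks 6 u v (l + 6) + 6 * path_walks 6 u v (l + 2)
    = 5 * path_walks 6 u v (l + 4) + path_walks 6 u v l"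
proof -
  have idx: "l + 2 = Suc (Suc l)" "l + 4 = Suc (Suc (Suc (Suc l)))"
    "l + 6 = Suc (Suc (Suc (Suc (Suc (Suc l)))))"
    by simp_all
  show ?thesis
    using assms unfolding atLeastAtMost_1_6 idx
    by (elim insertE emptyE) (simp_all add: path6_walks_Suc del: One_nat_def)
qed

section \<open>The two sequences\<close>

lemma A198636_recurrence:
  "A198636 (n + 3) = 5 * A198636 (n + 2) - 6 * A198636 (n + 1) + A198636 n"
proof -
  let ?w = "path_closed_walks 6"
  have "?w (2 * n + 6) + 6 * ?w (2 * n + 2) = 5 * ?w (2 * n + 4) + ?w (2 * n)"
    unfolding path_closed_walks_eq sum_distrib_left sum.distrib[symmetric]
    by (rule sum.cong[OF refl path6_walks_recurrence])
  then have "real (?w (2 * n + 6)) + 6 * real (?w (2 * n + 2))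
      = 5 * real (?w (2 * n + 4)) + real (?w (2 * n))"
    by linarith
  then show ?thesis
    unfolding A198636_def distrib_left by simp
qed

text \<open>The closed walks of lengths 0, 2 and 4 number 6, 10 and 26.\<close>

lemma A198636_initial: "A198636 0 = 3" "A198636 1 = 5" "A198636 2 = 13"
proof -
  have idx: "2 * 0 = (0::nat)" "2 * 1 = Suc (Suc 0)" "2 * 2 = Suc (Suc (Suc (Suc 0)))"
    by simp_all
  show "A198636 0 = 3" "A198636 1 = 5" "A198636 2 = 13"
    unfolding A198636_def path_closed_walks_eq atLeastAtMost_1_6 idx
    by (simp_all add: path6_walks_Suc path_walks_0 del: One_nat_def)
qed

lemma even_power_recurrence:
  fixes x :: "'a::comm_ring_1"
  assumes "x ^ 3 + x ^ 2 - 2 * x - 1 = 0"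
  shows "x ^ (2 * (n + 3)) = 5 * x ^ (2 * (n + 2)) - 6 * x ^ (2 * (n + 1)) + x ^ (2 * n)"
proof -
  \<comment> \<open>With p the cubic, the second factor is -p(-x), so the product is even, that is,
    a polynomial in \<open>x ^ 2\<close>.\<close>
  have "x ^ 6 - (5 * x ^ 4 - 6 * x ^ 2 + 1)
      = (x ^ 3 + x ^ 2 - 2 * x - 1) * (x ^ 3 - x ^ 2 - 2 * x + 1)"
    by (simp add: algebra_simps power_numeral_reduce)
  then have "x ^ 6 = 5 * x ^ 4 - 6 * x ^ 2 + 1"
    using assms by simp
  then have "x ^ (2 * n) * x ^ 6 = x ^ (2 * n) * (5 * x ^ 4 - 6 * x ^ 2 + 1)"
    by simp
  then show ?thesis
    unfolding distrib_left power_add by (simp add: algebra_simps power2_eq_square)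
qed

lemma A2_recurrence: "A2 (n + 3) = 5 * A2 (n + 2) - 6 * A2 (n + 1) + A2 n"
proof -
  let ?p = "[:-1, -2, 1, 1:] :: real poly"
  have "x ^ (2 * (n + 3)) = 5 * x ^ (2 * (n + 2)) - 6 * x ^ (2 * (n + 1)) + x ^ (2 * n)"
    if "x \<in># proots ?p" for x
  proof (rule even_power_recurrence)
    show "x ^ 3 + x ^ 2 - 2 * x - 1 = 0"
      using that by (simp add: algebra_simps power2_eq_square power3_eq_cube)
  qed
  then have "A2 (n + 3) = (\<Sum>x\<in>#proots ?p.
      5 * x ^ (2 * (n + 2)) - 6 * x ^ (2 * (n + 1)) + x ^ (2 * n))"
    unfolding A2_def by (intro arg_cong[where f = sum_mset] image_mset_cong)
  then show ?thesis
    unfolding A2_def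
    by (simp add: proots_eq algebra_simps del: mult_pCons_left)
qed

lemma A2_initial: "A2 0 = 3" "A2 1 = 5" "A2 2 = 13"
proof -
  define a b c where "a = 2 * cos (2 * pi / 7)" and "b = 2 * cos (4 * pi / 7)"
    and "c = 2 * cos (8 * pi / 7)"
  \<comment> \<open>Angle doubling expresses all three roots through \<open>a\<close>, so the power
    sums reduce to polynomials in \<open>a\<close> modulo its cubic.\<close>
  have b: "b = a\<^sup>2 - 2"
    using cos_double_cos[of "2 * pi / 7"] by (simp add: a_def b_def power2_eq_square)
  have c: "c = b\<^sup>2 - 2"
    using cos_double_cos[of "4 * pi / 7"] by (simp add: b_def c_def power2_eq_square)
  have "a \<in># proots [:-1, -2, 1, 1:]"
    unfolding proots_eq a_def by simp
  then have a: "a ^ 3 + a ^ 2 - 2 * a - 1 = 0"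
    by (simp add: algebra_simps power2_eq_square power3_eq_cube)
  show "A2 0 = 3"
    by (simp add: A2_eq)
  have "a\<^sup>2 + b\<^sup>2 + c\<^sup>2 = 5"
    using a b c by algebra
  then show "A2 1 = 5"
    by (simp add: A2_eq a_def b_def c_def)
  have "a ^ 4 + b ^ 4 + c ^ 4 = 13"
    using a b c by algebra
  then show "A2 2 = 13"
    by (simp add: A2_eq a_def b_def c_def)
qed

lemma A198636_eq_A2: "A198636 n = A2 n"
proof (induction n rule: less_induct)
  case (less n)
  consider "n = 0" | "n = 1" | "n = 2" | m where "n = m + 3"
    by (metis One_nat_def Suc_1 add.commute less_2_cases linorder_neqE_nat
        numeral_3_eq_3 Suc_leI le_Suc_ex)
  then show ?case
  proof cases
    case 4
    then show ?thesis
      using less.IH[of m] less.IH[of "m + 1"] less.IH[of "m + 2"]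
      by (simp add: A198636_recurrence A2_recurrence)
  qed (simp_all only: A198636_initial A2_initial)
qed

text \<open>Reflecting the angles 4 pi/7 and 8 pi/7 into the first quadrant only changes signs,
  which the even powers absorb.\<close>

lemma A2_eq_cos_pi_7:
  "A2 n = 2 ^ (2 * n) * (cos (pi / 7) ^ (2 * n) + cos (2 * pi / 7) ^ (2 * n)
     + cos (3 * pi / 7) ^ (2 * n))"
proof -
  have "cos (4 * pi / 7) = - cos (3 * pi / 7)"
    using cos_pi_minus[of "3 * pi / 7"] by (simp add: field_simps)
  moreover have "cos (8 * pi / 7) = - cos (pi / 7)"
    using cos_periodic_pi[of "pi / 7"] by (simp add: field_simps)
  ultimately show ?thesis
    by (simp add: A2_eq power_mult_distrib algebra_simps)
qed

theorem theorem21: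
  shows "linear_recurrent A198636
    \<and> A198636 = A2
    \<and> A198636 0 = 3 \<and> A198636 1 = 5 \<and> A198636 2 = 13
    \<and> (\<forall>n. A198636 (n + 3) = 5 * A198636 (n + 2) - 6 * A198636 (n + 1) + A198636 n)
    \<and> (\<forall>n. A198636 n =
          2 ^ (2 * n) * (cos (pi / 7) ^ (2 * n) + cos (2 * pi / 7) ^ (2 * n)
            + cos (3 * pi / 7) ^ (2 * n)))"
proof -
  have "linear_recurrent A198636"
    unfolding linear_recurrent_def
    \<comment> \<open>Coefficients are listed from the lowest shift upwards; as
      \<open>i < 3\<close>, the last branch is the case \<open>i = 2\<close>.\<close>
    by (rule exI[of _ 3], rule exI[of _ "\<lambda>i. if i = 0 then 1 else if i = 1 then -6 else 5"])
      (simp add: A198636_recurrence, simp add: eval_nat_numeral)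
  moreover have "A198636 = A2"
    by (rule ext) (rule A198636_eq_A2)
  ultimately show ?thesis
    using A198636_initial A198636_recurrence A198636_eq_A2 A2_eq_cos_pi_7 by metis
qed

end
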